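(* Let $q_n=(p_n,g_n)\in U\times G$, $n=0,\ldots,N$, and $\lambda^n=(\lambda^n_1,\ldots,\lambda^n_m)\in\mathbb{R}^m$, $n=0,\dots,N-1$. Put $W_n=g_n^{-1}g_{n+1}$, $A_n=A(p_n,p_{n+1})$ and $a_n=(p_n,p_{n+1},W_nA_n)\in U\times U\times G$ for $n=0,\ldots,N-1$. The discrete sequence $\{a_n,\lambda^n_\alpha\}$ is an extremum (critical point, $\delta\mathcal{S}_d=0$) of the action sum $$\mathcal{S}_d=\sum_{n=0}^{N-1}\Big(\mathcal{L}_d(a_n)+\lambda^n_\alpha\chi^\alpha_d(a_n)\Big)$$ with respect to the variations $$\delta a_n=\big(\delta p_n,\ \delta p_{n+1},\ -\eta_nW_nA_n+W_n\eta_{n+1}A_n+W_n\langle D_1A(p_n,p_{n+1}),\delta p_n\rangle+W_n\langle D_2A(p_n,p_{n+1}),\delta p_{n+1}\rangle\big),$$ where $\delta p_n\in T_{p_n}U$ and $\eta_n=g_n^{-1}\delta g_n\in\mathfrak{g}$ are arbitrary subject to the endpoint conditions $\delta q_0=\delta q_N=0$ (i.e. $\delta p_0=\delta p_N=0$, $\eta_0=\eta_N=0$), while the Lagrange multipliers $\lambda^n_\alpha$ are varied freely, if it is a solution of the discrete constrained Lagrange-Poincaré equations $$\begin{aligned}0=\;&D_1\mathcal{L}_d(a_n)+D_2\mathcal{L}_d(a_{n-1})+T^*\hat L_{(WA_1)}(n)D_3\mathcal{L}_d(a_n)+T^*\hat L_{(WA_2)}(n-1)D_3\mathcal{L}_d(a_{n-1})\\&+\lambda^n_\alpha\big\{D_1\chi^\alpha_d(a_n)+T^*\hat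 L_{(WA_1)}(n)D_3\chi^\alpha_d(a_n)\big\}+\lambda^{n-1}_\alpha\big\{D_2\chi^\alpha_d(a_{n-1})+T^*\hat L_{(WA_2)}(n-1)D_3\chi^\alpha_d(a_{n-1})\big\},\\ \mu_n=\;&\mathrm{Ad}^*_{W_{n-1}}\mu_{n-1}-\lambda^n_\alpha\varepsilon^\alpha_n+\lambda^{n-1}_\alpha\mathrm{Ad}^*_{W_{n-1}}\varepsilon^\alpha_{n-1}\end{aligned}$$ for $n=1,\ldots,N-1$, together with $0=\chi^\alpha_d(a_n)$ for $n=0,\ldots,N-1$ and $\alpha=1,\ldots,m$.
   Context: $G$ is a finite-dimensional Lie group with Lie algebra $\mathfrak{g}$, acting freely and properly on the left on a manifold $Q$ with principal bundle $\pi:Q\to Q/G$. $U\subset Q/G$ is an open set over which the bundle is trivialized, $\pi^{-1}(U)\cong U\times G$, with $G$ acting by left multiplication on the second factor. A discrete connection is a map $\mathcal{A}_d:Q\times Q\to G$ with $\mathcal{A}_d(q_0,gq_0)=g$ and $\mathcal{A}_d(gq_0,hq_1)=h\,\mathcal{A}_d(q_0,q_1)g^{-1}$; $A:U\times U\to G$ is its local representation, $A(p_0,p_1)=\mathcal{A}_d((p_0,e),(p_1,e))$. Via $[(p_0,g_0),(p_1,g_1)]_G\mapsto(p_0,p_1,g_0^{-1}g_1A(p_0,p_1))$ one identifies $((U\times G)\times(U\times G))/G$ with $U\times U\times G$, and $\mathcal{L}_d,\chi^\alpha_d:U\times U\times G\to\mathbb{R}$ ($\alpha=1,\dots,m$)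 are smooth functions, the (local expressions of the) discrete reduced Lagrangian and discrete reduced constraints. Repeated $\alpha$ is summed. $A$ is assumed smooth. $D_i$ is the partial derivative with respect to the $i$-th argument; for $v$ tangent to $U$, $\langle D_iA(p_n,p_{n+1}),v\rangle\in T_{A_n}G$. Products such as $\eta WA$, $W\eta A$, $W\langle D_iA,v\rangle$ denote tangent vectors obtained by applying tangent maps of left and right translations. The covectors $T^*\hat L_{(WA_1)}(n)\beta$ (for $\beta\in T^*_{W_nA_n}G$) and $T^*\hat L_{(WA_2)}(n-1)\beta$ (for $\beta\in T^*_{W_{n-1}A_{n-1}}G$) in $T^*_{p_n}U$ are defined by $$\langle T^*\hat L_{(WA_1)}(n)\beta,\delta p_n\rangle=\langle\beta,W_n\langle D_1A(p_n,p_{n+1}),\delta p_n\rangle\rangle,\qquad \langle T^*\hat L_{(WA_2)}(n-1)\beta,\delta p_n\rangle=\langle\beta,W_{n-1}\langle D_2A(p_{n-1},p_n),\delta p_n\rangle\rangle .$$ The elements $\mu_n,\varepsilon^\alpha_n\in\mathfrak{g}^*$ are the right-trivializations $$\langle\mu_n,\eta\rangle=\langle D_3\mathcal{L}_d(a_n),\eta W_nA_n\rangle,\qquad\langle\varepsilon^\alpha_n,\eta\rangle=\langle D_3\chi^\alpha_d(a_n),\eta W_nA_n\rangle,\qquad\eta\in\mathfrak{g},$$ and $\langle\mathrm{Ad}^*_W\mu,\eta\rangle=\langle\mu,\mathrm{Ad}_W\eta\rangle$. *)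

theory Defs
  imports "HOL-Analysis.Analysis" "HOL-Algebra.Group_Action"
begin

section \<open>Smooth manifolds\<close>

text \<open>For an open set \<open>S\<close> in a finite-dimensional space this is the usual notion of a \<open>C\<^sup>k\<close> map:
  all directional derivatives of order at most \<open>k\<close> exist and are continuous.\<close>

primrec Ck_on :: "nat \<Rightarrow> 'a::real_normed_vector set \<Rightarrow> ('a \<Rightarrow> 'b::real_normed_vector) \<Rightarrow> bool" where
  "Ck_on 0 S f \<longleftrightarrow> continuous_on S f"
| "Ck_on (Suc k) S f \<longleftrightarrow>
     (\<forall>x\<in>S. f differentiable (at x)) \<and>
     (\<forall>v. Ck_on k S (\<lambda>x. frechet_derivative f (at x) v))"

definition smooth_on :: "'a::real_normed_vector set \<Rightarrow> ('a \<Rightarrow> 'b::real_normed_vector) \<Rightarrow> bool" where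
  "smooth_on S f \<longleftrightarrow> (\<forall>k. Ck_on k S f)"

type_synonym ('a, 'e) chart = "'a set \<times> ('a \<Rightarrow> 'e)"

text \<open>A manifold carries an atlas and, at each point, a preferred chart of that atlas. The tangent
  space at \<open>x\<close> is the model space \<open>'e\<close>: the tangent vector \<open>v\<close> at \<open>x\<close> is the one whose
  coordinates in the preferred chart at \<open>x\<close> are \<open>v\<close>. Hence a tangent vector is always to be read
  together with its base point. The model space is a finite-dimensional normed space rather than a
  \<^class>\<open>euclidean_space\<close> because the latter class excludes dimension \<open>0\<close>, which is needed for
  discrete groups and for one-point bases.\<close>

record ('a, 'e) manifold =
  atlas :: "('a, 'e) chart set"
  chart_at :: "'a \<Rightarrow> ('a, 'e) chart"

definition points :: "('a, 'e) manifold \<Rightarrow> 'a set" where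
  "points M = \<Union>(fst ` atlas M)"

definition mfd_topology :: "('a, 'e::real_normed_vector) manifold \<Rightarrow> 'a topology" where
  "mfd_topology M = topology_generated_by
     {fst c \<inter> snd c -` T | c T. c \<in> atlas M \<and> open T}"

definition coord_rep :: "('a, 'e) chart \<Rightarrow> ('b, 'f) chart \<Rightarrow> ('a \<Rightarrow> 'b) \<Rightarrow> 'e \<Rightarrow> 'f" where
  "coord_rep c d f = snd d \<circ> f \<circ> inv_into (fst c) (snd c)"

definition smooth_map ::
  "('a, 'e::real_normed_vector) manifold \<Rightarrow> ('b, 'f::real_normed_vector) manifold \<Rightarrow> ('a \<Rightarrow> 'b) \<Rightarrow> bool" where
  "smooth_map M N f \<longleftrightarrow> f ` points M \<subseteq> points N \<and>
     (\<forall>c\<in>atlas M. \<forall>d\<in>atlas N.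
        open (snd c ` (fst c \<inter> f -` fst d)) \<and>
        smooth_on (snd c ` (fst c \<inter> f -` fst d)) (coord_rep c d f))"

text \<open>The condition on \<open>id\<close> says that the transition maps are smooth.\<close>

definition smooth_manifold :: "('a, 'e::real_normed_vector) manifold \<Rightarrow> bool" where
  "smooth_manifold M \<longleftrightarrow>
     (\<exists>B::'e set. finite B \<and> span B = UNIV) \<and>
     (\<forall>c\<in>atlas M. inj_on (snd c) (fst c) \<and> open (snd c ` fst c)) \<and>
     smooth_map M M id \<and>
     (\<forall>x\<in>points M. chart_at M x \<in> atlas M \<and> x \<in> fst (chart_at M x)) \<and>
     Hausdorff_space (mfd_topology M) \<and> second_countable (mfd_topology M)"

definition mfd_prod ::
  "('a, 'e) manifold \<Rightarrow> ('b, 'f) manifold \<Rightarrow> ('a \<times> 'b, 'e \<times> 'f) manifold" (infixr \<open>\<times>\<^sub>m\<close> 80) where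
  "M \<times>\<^sub>m N =
     \<lparr>atlas = {(fst c \<times> fst d, map_prod (snd c) (snd d)) | c d. c \<in> atlas M \<and> d \<in> atlas N},
      chart_at = (\<lambda>(x, y). (fst (chart_at M x) \<times> fst (chart_at N y),
                            map_prod (snd (chart_at M x)) (snd (chart_at N y))))\<rparr>"

definition open_sub :: "('a, 'e) manifold \<Rightarrow> 'a set \<Rightarrow> ('a, 'e) manifold" where
  "open_sub M U =
     \<lparr>atlas = (\<lambda>c. (fst c \<inter> U, snd c)) ` atlas M,
      chart_at = (\<lambda>x. (fst (chart_at M x) \<inter> U, snd (chart_at M x)))\<rparr>"

definition real_mfd :: "(real, real) manifold" where
  "real_mfd = \<lparr>atlas = {(UNIV, id)}, chart_at = (\<lambda>_. (UNIV, id))\<rparr>"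

text \<open>The tangent map \<open>T\<^sub>x f\<close> from the tangent space of \<open>M\<close> at \<open>x\<close> to that of \<open>N\<close> at \<open>f x\<close>. For
  \<open>N = real_mfd\<close> it is the differential of \<open>f\<close> at \<open>x\<close>, an element of the cotangent space.\<close>

definition tangent_map ::
  "('a, 'e::real_normed_vector) manifold \<Rightarrow> ('b, 'f::real_normed_vector) manifold \<Rightarrow>
     ('a \<Rightarrow> 'b) \<Rightarrow> 'a \<Rightarrow> 'e \<Rightarrow> 'f" where
  "tangent_map M N f x =
     frechet_derivative (coord_rep (chart_at M x) (chart_at N (f x)) f) (at (snd (chart_at M x) x))"

text \<open>A smooth curve, defined near \<open>0\<close>, through \<open>x\<close> with velocity \<open>v\<close> at time \<open>0\<close>.\<close>

definition smooth_curve ::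
  "('a, 'e::real_normed_vector) manifold \<Rightarrow> (real \<Rightarrow> 'a) \<Rightarrow> 'a \<Rightarrow> 'e \<Rightarrow> bool" where
  "smooth_curve M c x v \<longleftrightarrow>
     (\<exists>e>0. smooth_map (open_sub real_mfd {-e<..<e}) M c) \<and>
     c 0 = x \<and> tangent_map real_mfd M c 0 1 = v"

definition diffeomorphism ::
  "('a, 'e::real_normed_vector) manifold \<Rightarrow> ('b, 'f::real_normed_vector) manifold \<Rightarrow> ('a \<Rightarrow> 'b) \<Rightarrow> bool" where
  "diffeomorphism M N f \<longleftrightarrow> bij_betw f (points M) (points N) \<and>
     smooth_map M N f \<and> smooth_map N M (inv_into (points M) f)"


section \<open>Lie groups, principal bundles and discrete connections\<close>

locale lie_group = group G
  for G :: "('g, 'r) monoid_scheme" (structure) and GM :: "('g, 'eg::real_normed_vector) manifold" +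
  assumes group_manifold: "smooth_manifold GM"
    and group_points: "points GM = carrier G"
    and smooth_mult: "smooth_map (GM \<times>\<^sub>m GM) GM (\<lambda>(x, y). x \<otimes> y)"
    and smooth_inverse: "smooth_map GM GM (\<lambda>x. inv x)"

text \<open>The points of the base \<open>B = Q/G\<close> are the orbits, and the projection is the orbit map. Its
  smooth structure is the quotient structure, i.e. the one making the projection a submersion.\<close>

locale principal_bundle =
  lie_group G GM + group_action G "points Q" act
  for G :: "('g, 'r) monoid_scheme" (structure)
    and GM :: "('g, 'eg::real_normed_vector) manifold"
    and Q :: "('q, 'eq::real_normed_vector) manifold"
    and act :: "'g \<Rightarrow> 'q \<Rightarrow> 'q"
    and B :: "('q set, 'eb::real_normed_vector) manifold" +
  assumes total_manifold: "smooth_manifold Q"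
    and smooth_action: "smooth_map (GM \<times>\<^sub>m Q) Q (\<lambda>(g, q). act g q)"
    and free_action: "\<And>g q. g \<in> carrier G \<Longrightarrow> q \<in> points Q \<Longrightarrow> act g q = q \<Longrightarrow> g = \<one>"
    and proper_action:
      "proper_map (mfd_topology (GM \<times>\<^sub>m Q)) (mfd_topology (Q \<times>\<^sub>m Q)) (\<lambda>(g, q). (act g q, q))"
    and base_manifold: "smooth_manifold B"
    and base_points: "points B = orbits G (points Q) act"
    and smooth_projection: "smooth_map Q B (orbit G act)"
    and submersion: "\<And>q. q \<in> points Q \<Longrightarrow> range (tangent_map Q B (orbit G act) q) = UNIV"

locale trivialized_bundle = principal_bundle G GM Q act B
  for G :: "('g, 'r) monoid_scheme" (structure)
    and GM :: "('g, 'eg::real_normed_vector) manifold"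
    and Q :: "('q, 'eq::real_normed_vector) manifold"
    and act :: "'g \<Rightarrow> 'q \<Rightarrow> 'q"
    and B :: "('q set, 'eb::real_normed_vector) manifold" +
  fixes U :: "'q set set" and \<Phi> :: "'q set \<times> 'g \<Rightarrow> 'q"
  assumes open_U: "openin (mfd_topology B) U"
    and trivialization: "diffeomorphism (open_sub B U \<times>\<^sub>m GM)
           (open_sub Q {q \<in> points Q. orbit G act q \<in> U}) \<Phi>"
    and over_base: "\<And>x g. x \<in> U \<Longrightarrow> g \<in> carrier G \<Longrightarrow> orbit G act (\<Phi> (x, g)) = x"
    and equivariant: "\<And>x g h. x \<in> U \<Longrightarrow> g \<in> carrier G \<Longrightarrow> h \<in> carrier G \<Longrightarrow>
           \<Phi> (x, h \<otimes> g) = act h (\<Phi> (x, g))"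

definition discrete_connection ::
  "('g, 'r) monoid_scheme \<Rightarrow> 'q set \<Rightarrow> ('g \<Rightarrow> 'q \<Rightarrow> 'q) \<Rightarrow> ('q \<times> 'q \<Rightarrow> 'g) \<Rightarrow> bool" where
  "discrete_connection G E act \<A> \<longleftrightarrow>
     \<A> \<in> E \<times> E \<rightarrow> carrier G \<and>
     (\<forall>q\<^sub>0\<in>E. \<forall>g\<in>carrier G. \<A> (q\<^sub>0, act g q\<^sub>0) = g) \<and>
     (\<forall>q\<^sub>0\<in>E. \<forall>q\<^sub>1\<in>E. \<forall>g\<in>carrier G. \<forall>h\<in>carrier G.
        \<A> (act g q\<^sub>0, act h q\<^sub>1) = h \<otimes>\<^bsub>G\<^esub> \<A> (q\<^sub>0, q\<^sub>1) \<otimes>\<^bsub>G\<^esub> inv\<^bsub>G\<^esub> g)"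

definition local_rep ::
  "('g, 'r) monoid_scheme \<Rightarrow> ('b \<times> 'g \<Rightarrow> 'q) \<Rightarrow> ('q \<times> 'q \<Rightarrow> 'g) \<Rightarrow> 'b \<times> 'b \<Rightarrow> 'g" where
  "local_rep G \<Phi> \<A> = (\<lambda>(x, y). \<A> (\<Phi> (x, \<one>\<^bsub>G\<^esub>), \<Phi> (y, \<one>\<^bsub>G\<^esub>)))"


section \<open>Translations and partial derivatives\<close>

text \<open>\<open>ltrans G GM w h v\<close> is the product \<open>w v\<close> and \<open>rtrans G GM h v w\<close> the product \<open>v w\<close> of a group
  element \<open>w\<close> and a vector \<open>v\<close> tangent to the group at \<open>h\<close>. The Lie algebra is the tangent space
  at the identity.\<close>

definition ltrans ::
  "('g, 'r) monoid_scheme \<Rightarrow> ('g, 'eg::real_normed_vector) manifold \<Rightarrow> 'g \<Rightarrow> 'g \<Rightarrow> 'eg \<Rightarrow> 'eg" where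
  "ltrans G GM w h v = tangent_map GM GM (\<lambda>x. w \<otimes>\<^bsub>G\<^esub> x) h v"

definition rtrans ::
  "('g, 'r) monoid_scheme \<Rightarrow> ('g, 'eg::real_normed_vector) manifold \<Rightarrow> 'g \<Rightarrow> 'eg \<Rightarrow> 'g \<Rightarrow> 'eg" where
  "rtrans G GM h v w = tangent_map GM GM (\<lambda>x. x \<otimes>\<^bsub>G\<^esub> w) h v"

definition Ad ::
  "('g, 'r) monoid_scheme \<Rightarrow> ('g, 'eg::real_normed_vector) manifold \<Rightarrow> 'g \<Rightarrow> 'eg \<Rightarrow> 'eg" where
  "Ad G GM w = tangent_map GM GM (\<lambda>x. w \<otimes>\<^bsub>G\<^esub> x \<otimes>\<^bsub>G\<^esub> inv\<^bsub>G\<^esub> w) \<one>\<^bsub>G\<^esub>"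

definition Ad_star ::
  "('g, 'r) monoid_scheme \<Rightarrow> ('g, 'eg::real_normed_vector) manifold \<Rightarrow> 'g \<Rightarrow> ('eg \<Rightarrow> real) \<Rightarrow> 'eg \<Rightarrow> real" where
  "Ad_star G GM w \<mu> = (\<lambda>\<eta>. \<mu> (Ad G GM w \<eta>))"

text \<open>\<open>D1\<close>, \<open>D2\<close>, \<open>D3\<close> are the partial derivatives of a real function on \<open>M \<times> M \<times> GM\<close>;
  \<open>DA1\<close>, \<open>DA2\<close> those of a \<open>GM\<close>-valued map on \<open>M \<times> M\<close>.\<close>

definition D1 :: "('b, 'eb::real_normed_vector) manifold \<Rightarrow> ('b \<times> 'b \<times> 'g \<Rightarrow> real) \<Rightarrow> 'b \<times> 'b \<times> 'g \<Rightarrow> 'eb \<Rightarrow> real" where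
  "D1 M f = (\<lambda>(x, y, w). tangent_map M real_mfd (\<lambda>x'. f (x', y, w)) x)"

definition D2 :: "('b, 'eb::real_normed_vector) manifold \<Rightarrow> ('b \<times> 'b \<times> 'g \<Rightarrow> real) \<Rightarrow> 'b \<times> 'b \<times> 'g \<Rightarrow> 'eb \<Rightarrow> real" where
  "D2 M f = (\<lambda>(x, y, w). tangent_map M real_mfd (\<lambda>y'. f (x, y', w)) y)"

definition D3 :: "('g, 'eg::real_normed_vector) manifold \<Rightarrow> ('b \<times> 'b \<times> 'g \<Rightarrow> real) \<Rightarrow> 'b \<times> 'b \<times> 'g \<Rightarrow> 'eg \<Rightarrow> real" where
  "D3 GM f = (\<lambda>(x, y, w). tangent_map GM real_mfd (\<lambda>w'. f (x, y, w')) w)"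

definition DA1 ::
  "('b, 'eb::real_normed_vector) manifold \<Rightarrow> ('g, 'eg::real_normed_vector) manifold \<Rightarrow>
     ('b \<times> 'b \<Rightarrow> 'g) \<Rightarrow> 'b \<times> 'b \<Rightarrow> 'eb \<Rightarrow> 'eg" where
  "DA1 M GM A = (\<lambda>(x, y). tangent_map M GM (\<lambda>x'. A (x', y)) x)"

definition DA2 ::
  "('b, 'eb::real_normed_vector) manifold \<Rightarrow> ('g, 'eg::real_normed_vector) manifold \<Rightarrow>
     ('b \<times> 'b \<Rightarrow> 'g) \<Rightarrow> 'b \<times> 'b \<Rightarrow> 'eb \<Rightarrow> 'eg" where
  "DA2 M GM A = (\<lambda>(x, y). tangent_map M GM (\<lambda>y'. A (x, y')) y)"

text \<open>\<open>T_LWA1 G GM M A w (x, y) \<beta>\<close> is the covector at \<open>x\<close> and \<open>T_LWA2 G GM M A w (x, y) \<beta>\<close> the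
  covector at \<open>y\<close> obtained from a covector \<open>\<beta>\<close> of the group at \<open>w A(x, y)\<close>.\<close>

definition T_LWA1 ::
  "('g, 'r) monoid_scheme \<Rightarrow> ('g, 'eg::real_normed_vector) manifold \<Rightarrow>
     ('b, 'eb::real_normed_vector) manifold \<Rightarrow> ('b \<times> 'b \<Rightarrow> 'g) \<Rightarrow>
     'g \<Rightarrow> 'b \<times> 'b \<Rightarrow> ('eg \<Rightarrow> real) \<Rightarrow> 'eb \<Rightarrow> real" where
  "T_LWA1 G GM M A w xy \<beta> = (\<lambda>v. \<beta> (ltrans G GM w (A xy) (DA1 M GM A xy v)))"

definition T_LWA2 ::
  "('g, 'r) monoid_scheme \<Rightarrow> ('g, 'eg::real_normed_vector) manifold \<Rightarrow>
     ('b, 'eb::real_normed_vector) manifold \<Rightarrow> ('b \<times> 'b \<Rightarrow> 'g) \<Rightarrow>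
     'g \<Rightarrow> 'b \<times> 'b \<Rightarrow> ('eg \<Rightarrow> real) \<Rightarrow> 'eb \<Rightarrow> real" where
  "T_LWA2 G GM M A w xy \<beta> = (\<lambda>v. \<beta> (ltrans G GM w (A xy) (DA2 M GM A xy v)))"


section \<open>The action sum\<close>

text \<open>\<open>\<kappa> \<alpha>\<close>, for \<open>\<alpha> = 1, \<dots>, m\<close>, are the constraint functions \<open>\<chi>\<^sub>d\<^sup>\<alpha>\<close> (the letter chi is the vector
  binder of \<^theory>\<open>HOL-Analysis.Finite_Cartesian_Product\<close>).\<close>

definition action_sum ::
  "nat \<Rightarrow> nat \<Rightarrow> ('a \<Rightarrow> real) \<Rightarrow> (nat \<Rightarrow> 'a \<Rightarrow> real) \<Rightarrow> (nat \<Rightarrow> 'a) \<Rightarrow> (nat \<Rightarrow> nat \<Rightarrow> real) \<Rightarrow> real" where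
  "action_sum N m L \<kappa> a lam = (\<Sum>n<N. L (a n) + (\<Sum>\<alpha>=1..m. lam n \<alpha> * \<kappa> \<alpha> (a n)))"

text \<open>\<open>\<delta>S = 0\<close> for the variation \<open>(\<delta>a, \<delta>lam)\<close> of \<open>(a, lam)\<close>: the derivative at time \<open>0\<close> of the action
  sum along every family of smooth curves through \<open>(a, lam)\<close> with velocity \<open>(\<delta>a, \<delta>lam)\<close> vanishes.\<close>

definition stationary_along ::
  "('a, 'e::real_normed_vector) manifold \<Rightarrow> nat \<Rightarrow> nat \<Rightarrow> ('a \<Rightarrow> real) \<Rightarrow> (nat \<Rightarrow> 'a \<Rightarrow> real) \<Rightarrow>
     (nat \<Rightarrow> 'a) \<Rightarrow> (nat \<Rightarrow> nat \<Rightarrow> real) \<Rightarrow> (nat \<Rightarrow> 'e) \<Rightarrow> (nat \<Rightarrow> nat \<Rightarrow> real) \<Rightarrow> bool" where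
  "stationary_along M N m L \<kappa> a lam \<delta>a \<delta>lam \<longleftrightarrow>
     (\<forall>c l. (\<forall>n<N. smooth_curve M (c n) (a n) (\<delta>a n)) \<and>
            (\<forall>n<N. \<forall>\<alpha>\<in>{1..m}. smooth_curve real_mfd (l n \<alpha>) (lam n \<alpha>) (\<delta>lam n \<alpha>)) \<longrightarrow>
        ((\<lambda>t. action_sum N m L \<kappa> (\<lambda>n. c n t) (\<lambda>n \<alpha>. l n \<alpha> t)) has_real_derivative 0) (at 0))"

end

theory Submission
  imports Defs
begin

text \<open>Let \<open>f\<close> be \<open>L\<close> or one of the constraint functions. Its differential at \<open>a\<^sub>n\<close> is the sum of its
  three partial differentials, so \<open>df(a\<^sub>n)(\<delta>a\<^sub>n)\<close> is a sum of terms linear in \<open>\<delta>p\<^sub>n\<close>, \<open>\<delta>p\<^sub>n\<^sub>+\<^sub>1\<close>, \<open>\<eta>\<^sub>n\<close> and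
  \<open>\<eta>\<^sub>n\<^sub>+\<^sub>1\<close>. Only the term containing \<open>W\<^sub>n \<eta>\<^sub>n\<^sub>+\<^sub>1 A\<^sub>n\<close> is not yet in the form in which the equations of
  motion express it, and the identity \<open>W \<eta> A = (Ad\<^sub>W \<eta>) W A\<close> (\<open>ltrans_rtrans_eq_rtrans_Ad\<close>) turns it
  into \<open>Ad\<^sup>*\<close> of the right-trivialized covector. The outcome is \<open>differential_reduced_variation\<close>.

  Along curves with velocity \<open>(\<delta>a, \<delta>lam)\<close> the action sum has derivative
  \<open>\<Sum>\<^sub>n dL(a\<^sub>n)(\<delta>a\<^sub>n) + \<Sum>\<^sub>\<alpha> lam\<^sup>n\<^sub>\<alpha> d\<kappa>\<^sup>\<alpha>(a\<^sub>n)(\<delta>a\<^sub>n)\<close> (\<open>action_sum_derivative\<close>): the variation of the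
  multipliers contributes \<open>\<delta>lam\<^sup>n\<^sub>\<alpha> \<kappa>\<^sup>\<alpha>(a\<^sub>n)\<close>, which the constraints annihilate. Collecting, for each
  interior \<open>n\<close>, the terms in \<open>\<delta>p\<^sub>n\<close> and \<open>\<eta>\<^sub>n\<close> (\<open>sum_by_parts_eq_zero\<close>) yields the horizontal equation
  applied to \<open>\<delta>p\<^sub>n\<close> and the vertical equation applied to \<open>\<eta>\<^sub>n\<close>, while the boundary terms vanish by the
  endpoint conditions.

  All this rests on the chain rule for tangent maps and on the fact that the partial derivatives are
  the restrictions of the total one to the factors; both are local statements about preferred charts.\<close>

section \<open>Tangent maps at a point\<close>

text \<open>The local part of being a manifold on which differentiation in preferred charts depends. Unlike
  smoothness of the whole manifold it passes to subsets and products by inspection of the charts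
  alone.\<close>

definition charted :: "('a, 'e::real_normed_vector) manifold \<Rightarrow> 'a \<Rightarrow> bool" where
  "charted M x \<longleftrightarrow> chart_at M x \<in> atlas M \<and> x \<in> fst (chart_at M x) \<and>
     inj_on (snd (chart_at M x)) (fst (chart_at M x))"

text \<open>The first clause alone would not determine \<open>f\<close> near \<open>x\<close>: outside the chart domains the
  coordinate expression takes arbitrary values. The second clause says that near \<open>x\<close> it is built from
  genuine points, with \<open>f\<close> mapping into the chart at \<open>f x\<close>; it is what makes the chain rule true.\<close>

definition has_tangent_map ::
  "('a, 'e::real_normed_vector) manifold \<Rightarrow> ('b, 'f::real_normed_vector) manifold \<Rightarrow>
     ('a \<Rightarrow> 'b) \<Rightarrow> 'a \<Rightarrow> ('e \<Rightarrow> 'f) \<Rightarrow> bool" where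
  "has_tangent_map M N f x T \<longleftrightarrow>
     (coord_rep (chart_at M x) (chart_at N (f x)) f has_derivative T) (at (snd (chart_at M x) x)) \<and>
     (\<forall>\<^sub>F u in nhds (snd (chart_at M x) x).
        u \<in> snd (chart_at M x) ` (fst (chart_at M x) \<inter> f -` fst (chart_at N (f x))))"

lemma has_tangent_map_unique:
  "has_tangent_map M N f x T \<Longrightarrow> tangent_map M N f x = T"
  unfolding has_tangent_map_def tangent_map_def by (metis frechet_derivative_at)

lemma has_tangent_map_linear: "has_tangent_map M N f x T \<Longrightarrow> bounded_linear T"
  unfolding has_tangent_map_def by (blast intro: has_derivative_bounded_linear)

lemma charted_fst_subset: "charted M x \<Longrightarrow> fst (chart_at M x) \<subseteq> points M"
  unfolding charted_def points_def by blast

lemma charted_smooth_manifold: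
  "smooth_manifold M \<Longrightarrow> x \<in> points M \<Longrightarrow> charted M x"
  unfolding smooth_manifold_def charted_def by blast

lemma charted_open_sub:
  "charted M x \<Longrightarrow> x \<in> U \<Longrightarrow> charted (open_sub M U) x"
  unfolding charted_def open_sub_def by (auto intro: inj_on_subset)

lemma charted_prod:
  "charted M x \<Longrightarrow> charted N y \<Longrightarrow> charted (M \<times>\<^sub>m N) (x, y)"
  unfolding charted_def mfd_prod_def
  by (auto simp: map_prod_inj_on intro!: exI[of _ "fst (chart_at M x)"] exI[of _ "snd (chart_at M x)"]
      exI[of _ "fst (chart_at N y)"] exI[of _ "snd (chart_at N y)"])

lemma charted_real: "charted real_mfd x"
  unfolding charted_def real_mfd_def by simp

text \<open>Smoothness gives differentiability of order one in every pair of charts, in particular in the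
  preferred ones, and the openness it includes is exactly the neighbourhood condition.\<close>

lemma smooth_map_has_tangent_map:
  assumes "smooth_map M N f" "charted M x" "charted N (f x)"
  shows "has_tangent_map M N f x (tangent_map M N f x)"
proof -
  let ?c = "chart_at M x" and ?d = "chart_at N (f x)"
  let ?S = "snd ?c ` (fst ?c \<inter> f -` fst ?d)"
  have S: "open ?S" "smooth_on ?S (coord_rep ?c ?d f)"
    using assms unfolding smooth_map_def charted_def by blast+
  have x: "snd ?c x \<in> ?S"
    using assms unfolding charted_def by blast
  have "Ck_on (Suc 0) ?S (coord_rep ?c ?d f)"
    using S(2) unfolding smooth_on_def by blast
  then have "coord_rep ?c ?d f differentiable at (snd ?c x)"
    using x by (simp only: Ck_on.simps)
  moreover have "\<forall>\<^sub>F u in nhds (snd ?c x). u \<in> ?S"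
    using S(1) x by (rule eventually_nhds_in_open)
  ultimately show ?thesis
    unfolding has_tangent_map_def tangent_map_def by (simp add: frechet_derivative_works)
qed

lemma has_derivative_eventually_eq:
  assumes "(f has_derivative T) (at x)" "\<forall>\<^sub>F u in nhds x. h u = f u"
  shows "(h has_derivative T) (at x)"
  using assms(1)
  by (rule has_derivative_transform_eventually)
    (use assms(2) in \<open>auto simp: eventually_nhds eventually_at_topological\<close>)

text \<open>Coordinate expressions only see the map on the chart domain. This matters for group identities,
  which hold on the carrier but not necessarily on the whole type.\<close>

lemma has_tangent_map_cong:
  assumes "has_tangent_map M N f x T" "charted M x"
    and eq: "\<And>y. y \<in> fst (chart_at M x) \<Longrightarrow> f y = h y"
  shows "has_tangent_map M N h x T"
proof -
  let ?c = "chart_at M x" and ?d = "chart_at N (f x)"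
  have fx: "h x = f x"
    using assms(2) eq[of x] by (simp add: charted_def)
  have ev: "\<forall>\<^sub>F u in nhds (snd ?c x). u \<in> snd ?c ` (fst ?c \<inter> f -` fst ?d)"
    and der: "(coord_rep ?c ?d f has_derivative T) (at (snd ?c x))"
    using assms(1) unfolding has_tangent_map_def by auto
  have ev': "\<forall>\<^sub>F u in nhds (snd ?c x). coord_rep ?c ?d h u = coord_rep ?c ?d f u"
    using ev by eventually_elim (auto simp: coord_rep_def eq inv_into_into)
  have "(coord_rep ?c ?d h has_derivative T) (at (snd ?c x))"
    using der ev' by (rule has_derivative_eventually_eq)
  moreover have "fst ?c \<inter> f -` fst ?d = fst ?c \<inter> h -` fst ?d"
    using eq by auto
  ultimately show ?thesis
    using ev unfolding has_tangent_map_def fx by simp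
qed

text \<open>The chain rule. Near \<open>x\<close> the coordinate expression of the composition is the composition of the
  coordinate expressions, because \<open>f\<close> stays in the intermediate chart, where the chart map can be
  cancelled against its inverse.\<close>

lemma has_tangent_map_comp:
  assumes f: "has_tangent_map M N f x S" and h: "has_tangent_map N K h (f x) T"
    and M: "charted M x" and N: "charted N (f x)"
  shows "has_tangent_map M K (\<lambda>x. h (f x)) x (\<lambda>v. T (S v))"
proof -
  let ?c = "chart_at M x" and ?d = "chart_at N (f x)" and ?e = "chart_at K (h (f x))"
  have c: "inj_on (snd ?c) (fst ?c)" "x \<in> fst ?c" and d: "inj_on (snd ?d) (fst ?d)"
    using M N by (auto simp: charted_def)
  have x: "coord_rep ?c ?d f (snd ?c x) = snd ?d (f x)"
    using c by (simp add: coord_rep_def)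
  have evf: "\<forall>\<^sub>F u in nhds (snd ?c x). u \<in> snd ?c ` (fst ?c \<inter> f -` fst ?d)"
    and derf: "(coord_rep ?c ?d f has_derivative S) (at (snd ?c x))"
    using f unfolding has_tangent_map_def by auto
  have evh: "\<forall>\<^sub>F u in nhds (snd ?d (f x)). u \<in> snd ?d ` (fst ?d \<inter> h -` fst ?e)"
    and derh: "(coord_rep ?d ?e h has_derivative T) (at (snd ?d (f x)))"
    using h unfolding has_tangent_map_def by auto
  have "isCont (coord_rep ?c ?d f) (snd ?c x)"
    using derf by (rule has_derivative_continuous)
  then have "filterlim (coord_rep ?c ?d f) (nhds (snd ?d (f x))) (nhds (snd ?c x))"
    using x by (metis isCont_def tendsto_at_iff_tendsto_nhds)
  then have evhf: "\<forall>\<^sub>F u in nhds (snd ?c x).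
      coord_rep ?c ?d f u \<in> snd ?d ` (fst ?d \<inter> h -` fst ?e)"
    using evh unfolding filterlim_iff by blast
  have ev: "\<forall>\<^sub>F u in nhds (snd ?c x).
      coord_rep ?c ?e (\<lambda>x. h (f x)) u = coord_rep ?d ?e h (coord_rep ?c ?d f u) \<and>
      u \<in> snd ?c ` (fst ?c \<inter> (\<lambda>x. h (f x)) -` fst ?e)"
    using evf evhf
  proof eventually_elim
    case (elim u)
    then obtain y where y: "u = snd ?c y" "y \<in> fst ?c" "f y \<in> fst ?d" by auto
    then have inv: "inv_into (fst ?c) (snd ?c) u = y" using c by simp
    from elim(2) have "h (f y) \<in> fst ?e"
      using y(3) d by (auto simp: coord_rep_def inv dest: inj_onD)
    then show ?case
      using y d inv by (auto simp: coord_rep_def)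
  qed
  have comp: "((\<lambda>u. coord_rep ?d ?e h (coord_rep ?c ?d f u)) has_derivative (\<lambda>v. T (S v))) (at (snd ?c x))"
    using has_derivative_compose[OF derf, of "coord_rep ?d ?e h" T] derh x by simp
  have "(coord_rep ?c ?e (\<lambda>x. h (f x)) has_derivative (\<lambda>v. T (S v))) (at (snd ?c x))"
    using ev by (intro has_derivative_eventually_eq[OF comp]) (simp add: eventually_conj_iff)
  then show ?thesis
    using ev unfolding has_tangent_map_def by (auto simp: eventually_conj_iff)
qed

text \<open>Restriction of \<open>f\<close> along an embedding \<open>i\<close> which in the preferred charts is the map \<open>j\<close>. The
  hypothesis \<open>full\<close> says that the chart of \<open>M\<close> is everything that \<open>j\<close> sends into the chart of \<open>P\<close>, so
  that the neighbourhood of \<open>i x\<close> on which \<open>f\<close> is controlled pulls back to one of \<open>x\<close>. Its purpose is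
  the inclusion of a factor into a product, which turns total into partial derivatives.\<close>

lemma has_tangent_map_slice:
  assumes f: "has_tangent_map P K f (i x) T" and M: "charted M x" and P: "charted P (i x)"
    and i: "\<And>z. z \<in> fst (chart_at M x) \<Longrightarrow> i z \<in> fst (chart_at P (i x)) \<and>
              snd (chart_at P (i x)) (i z) = j (snd (chart_at M x) z)"
    and full: "\<And>u. j u \<in> snd (chart_at P (i x)) ` fst (chart_at P (i x)) \<Longrightarrow>
                 u \<in> snd (chart_at M x) ` fst (chart_at M x)"
    and j: "(j has_derivative J) (at (snd (chart_at M x) x))"
  shows "has_tangent_map M K (\<lambda>z. f (i z)) x (\<lambda>v. T (J v))"
proof -
  let ?c = "chart_at M x" and ?d = "chart_at P (i x)" and ?e = "chart_at K (f (i x))"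
  have c: "inj_on (snd ?c) (fst ?c)" "x \<in> fst ?c" and d: "inj_on (snd ?d) (fst ?d)"
    using M P by (auto simp: charted_def)
  have jx: "j (snd ?c x) = snd ?d (i x)" using i c(2) by simp
  have ev0: "\<forall>\<^sub>F u in nhds (j (snd ?c x)). u \<in> snd ?d ` (fst ?d \<inter> f -` fst ?e)"
    and der: "(coord_rep ?d ?e f has_derivative T) (at (j (snd ?c x)))"
    using f unfolding has_tangent_map_def jx by auto
  have "filterlim j (nhds (j (snd ?c x))) (nhds (snd ?c x))"
    using has_derivative_continuous[OF j] by (metis isCont_def tendsto_at_iff_tendsto_nhds)
  then have ev1: "\<forall>\<^sub>F u in nhds (snd ?c x). j u \<in> snd ?d ` (fst ?d \<inter> f -` fst ?e)"
    using ev0 unfolding filterlim_iff by blast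
  have ev: "\<forall>\<^sub>F u in nhds (snd ?c x).
      coord_rep ?c ?e (\<lambda>z. f (i z)) u = coord_rep ?d ?e f (j u) \<and>
      u \<in> snd ?c ` (fst ?c \<inter> (\<lambda>z. f (i z)) -` fst ?e)"
    using ev1
  proof eventually_elim
    case (elim u)
    then obtain z where z: "u = snd ?c z" "z \<in> fst ?c" using full by blast
    with elim obtain y where y: "snd ?d (i z) = snd ?d y" "y \<in> fst ?d" "f y \<in> fst ?e"
      using i by auto
    then have "y = i z" using d i z(2) by (metis inj_onD)
    with y have "f (i z) \<in> fst ?e" by simp
    moreover have "inv_into (fst ?d) (snd ?d) (j u) = i z"
      using i[OF z(2)] d z(1) by (metis inv_into_f_f)
    ultimately show ?case
      using z c by (auto simp: coord_rep_def)
  qed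
  have comp: "((\<lambda>u. coord_rep ?d ?e f (j u)) has_derivative (\<lambda>v. T (J v))) (at (snd ?c x))"
    using j der by (rule has_derivative_compose)
  have "(coord_rep ?c ?e (\<lambda>z. f (i z)) has_derivative (\<lambda>v. T (J v))) (at (snd ?c x))"
    using ev by (intro has_derivative_eventually_eq[OF comp]) (simp add: eventually_conj_iff)
  then show ?thesis
    using ev unfolding has_tangent_map_def by (auto simp: eventually_conj_iff)
qed

lemma has_tangent_map_slice1:
  assumes f: "has_tangent_map (M \<times>\<^sub>m N) K f (x, y) T" and M: "charted M x" and N: "charted N y"
  shows "has_tangent_map M K (\<lambda>x'. f (x', y)) x (\<lambda>v. T (v, 0))"
  using M N
  by (intro has_tangent_map_slice[where i = "\<lambda>x'. (x', y)" and x = x and P = "M \<times>\<^sub>m N"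
        and j = "\<lambda>u. (u, snd (chart_at N y) y)" and J = "\<lambda>v. (v, 0)", OF f M charted_prod[OF M N]])
    (auto simp: mfd_prod_def charted_def intro!: derivative_eq_intros)

lemma has_tangent_map_slice2:
  assumes f: "has_tangent_map (M \<times>\<^sub>m N) K f (x, y) T" and M: "charted M x" and N: "charted N y"
  shows "has_tangent_map N K (\<lambda>y'. f (x, y')) y (\<lambda>v. T (0, v))"
  using M N
  by (intro has_tangent_map_slice[where i = "\<lambda>y'. (x, y')" and x = y and P = "M \<times>\<^sub>m N"
        and j = "\<lambda>u. (snd (chart_at M x) x, u)" and J = "\<lambda>v. (0, v)", OF f N charted_prod[OF M N]])
    (auto simp: mfd_prod_def charted_def intro!: derivative_eq_intros)

section \<open>Curves and real-valued functions\<close>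

text \<open>A smooth curve is smooth for the chart of an open interval around \<open>0\<close>, but its velocity is
  computed in the chart of the whole line. Near \<open>0\<close> the two coordinate expressions agree.\<close>

lemma smooth_curve_has_tangent_map:
  assumes "smooth_curve M c x v" and M: "charted M x"
  shows "has_tangent_map real_mfd M c 0 (\<lambda>t. t *\<^sub>R v)"
proof -
  obtain e where e: "e > 0" and sm: "smooth_map (open_sub real_mfd {-e<..<e}) M c"
    and x: "c 0 = x" and v: "tangent_map real_mfd M c 0 1 = v"
    using assms(1) unfolding smooth_curve_def by auto
  let ?R = "open_sub real_mfd {-e<..<e}"
  have "charted ?R 0"
    using charted_open_sub[OF charted_real] e by simp
  then have "has_tangent_map ?R M c 0 (tangent_map ?R M c 0)"
    using sm M x by (intro smooth_map_has_tangent_map) auto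
  then have der: "(coord_rep ({-e<..<e}, id) (chart_at M x) c has_derivative tangent_map ?R M c 0) (at 0)"
    and ev: "\<forall>\<^sub>F t in nhds 0. t \<in> {-e<..<e} \<inter> c -` fst (chart_at M x)"
    by (auto simp: has_tangent_map_def open_sub_def real_mfd_def x)
  have "\<forall>\<^sub>F t in nhds 0. coord_rep (UNIV, id) (chart_at M x) c t
      = coord_rep ({-e<..<e}, id) (chart_at M x) c t"
    using ev
  proof eventually_elim
    case (elim t)
    then have "inv_into {-e<..<e} id t = t"
      using inv_into_f_f[of id "{-e<..<e}" t] by simp
    then show ?case by (simp add: coord_rep_def)
  qed
  then have "(coord_rep (UNIV, id) (chart_at M x) c has_derivative tangent_map ?R M c 0) (at 0)"
    using has_derivative_eventually_eq[OF der] by simp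
  moreover have "\<forall>\<^sub>F t in nhds 0. t \<in> c -` fst (chart_at M x)"
    using ev by eventually_elim auto
  ultimately have has: "has_tangent_map real_mfd M c 0 (tangent_map ?R M c 0)"
    by (auto simp: has_tangent_map_def real_mfd_def x)
  then have T: "tangent_map ?R M c 0 1 = v"
    using v has_tangent_map_unique by metis
  interpret bounded_linear "tangent_map ?R M c 0"
    using has by (rule has_tangent_map_linear)
  have "tangent_map ?R M c 0 = (\<lambda>t. t *\<^sub>R v)"
  proof
    fix t show "tangent_map ?R M c 0 t = t *\<^sub>R v"
      using scale[of t 1] T by simp
  qed
  then show ?thesis using has by simp
qed

lemma has_tangent_map_real_iff:
  "has_tangent_map real_mfd real_mfd h t T \<longleftrightarrow> (h has_derivative T) (at t)"
  by (simp add: has_tangent_map_def real_mfd_def coord_rep_def o_def)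

lemma derivative_along_smooth_curve:
  assumes c: "smooth_curve M c x v" and M: "charted M x"
    and f: "has_tangent_map M real_mfd f x T"
  shows "((\<lambda>t. f (c t)) has_real_derivative T v) (at 0)"
proof -
  have x: "c 0 = x" using c by (simp add: smooth_curve_def)
  have "has_tangent_map real_mfd real_mfd (\<lambda>t. f (c t)) 0 (\<lambda>t. T (t *\<^sub>R v))"
    using has_tangent_map_comp[OF smooth_curve_has_tangent_map[OF c M]] f x M
    by (simp add: charted_real)
  then have "((\<lambda>t. f (c t)) has_derivative (\<lambda>t. T (t *\<^sub>R v))) (at 0)"
    by (simp add: has_tangent_map_real_iff)
  moreover have "(\<lambda>t. T (t *\<^sub>R v)) = (*) (T v)"
    using bounded_linear.linear[OF has_tangent_map_linear[OF f]] by (auto simp: linear_cmul)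
  ultimately show ?thesis by (simp add: has_field_derivative_def)
qed

lemma derivative_smooth_real_curve:
  "smooth_curve real_mfd l x v \<Longrightarrow> (l has_real_derivative v) (at 0)"
  using derivative_along_smooth_curve[of real_mfd l x v "\<lambda>t. t" "\<lambda>t. t"]
  by (simp add: charted_real has_tangent_map_real_iff)

section \<open>Translations in a Lie group\<close>

context lie_group
begin

lemma charted_group: "x \<in> carrier G \<Longrightarrow> charted GM x"
  using group_manifold group_points by (simp add: charted_smooth_manifold)

lemma has_tangent_map_mult:
  assumes "x \<in> carrier G" "y \<in> carrier G"
  shows "has_tangent_map (GM \<times>\<^sub>m GM) GM (\<lambda>(x, y). x \<otimes> y) (x, y)
           (tangent_map (GM \<times>\<^sub>m GM) GM (\<lambda>(x, y). x \<otimes> y) (x, y))"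
  using assms by (intro smooth_map_has_tangent_map smooth_mult charted_prod) (auto intro: charted_group)

lemma has_tangent_map_ltrans:
  assumes "w \<in> carrier G" "h \<in> carrier G"
  shows "has_tangent_map GM GM (\<lambda>x. w \<otimes> x) h (ltrans G GM w h)"
proof -
  from has_tangent_map_slice2[OF has_tangent_map_mult[OF assms]] assms charted_group
  have *: "has_tangent_map GM GM (\<lambda>x. w \<otimes> x) h
        (\<lambda>v. tangent_map (GM \<times>\<^sub>m GM) GM (\<lambda>(x, y). x \<otimes> y) (w, h) (0, v))"
    by simp
  from has_tangent_map_unique[OF this] * show ?thesis
    by (simp add: ltrans_def[abs_def])
qed

lemma has_tangent_map_rtrans:
  assumes "w \<in> carrier G" "h \<in> carrier G"
  shows "has_tangent_map GM GM (\<lambda>x. x \<otimes> w) h (\<lambda>v. rtrans G GM h v w)"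
proof -
  from has_tangent_map_slice1[OF has_tangent_map_mult[OF assms(2,1)]] assms charted_group
  have *: "has_tangent_map GM GM (\<lambda>x. x \<otimes> w) h
        (\<lambda>v. tangent_map (GM \<times>\<^sub>m GM) GM (\<lambda>(x, y). x \<otimes> y) (h, w) (v, 0))"
    by simp
  from has_tangent_map_unique[OF this] * show ?thesis
    by (simp add: rtrans_def[abs_def])
qed

lemma has_tangent_map_Ad:
  assumes "w \<in> carrier G"
  shows "has_tangent_map GM GM (\<lambda>x. w \<otimes> x \<otimes> inv w) \<one> (Ad G GM w)"
proof -
  have "has_tangent_map GM GM (\<lambda>x. w \<otimes> x \<otimes> inv w) \<one>
          (\<lambda>v. rtrans G GM (w \<otimes> \<one>) (ltrans G GM w \<one> v) (inv w))"
    using assms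
    by (intro has_tangent_map_comp[OF has_tangent_map_ltrans has_tangent_map_rtrans] charted_group) auto
  from has_tangent_map_unique[OF this] this show ?thesis
    by (simp add: Ad_def)
qed

text \<open>Both sides are the tangent map at the identity of the one map \<open>x \<mapsto> w x b = (w x w\<inverse>) (w b)\<close>,
  factored in two ways.\<close>

lemma ltrans_rtrans_eq_rtrans_Ad:
  assumes w: "w \<in> carrier G" and b: "b \<in> carrier G"
  shows "ltrans G GM w b (rtrans G GM \<one> \<eta> b) = rtrans G GM \<one> (Ad G GM w \<eta>) (w \<otimes> b)"
proof -
  have "has_tangent_map GM GM (\<lambda>x. w \<otimes> (x \<otimes> b)) \<one>
          (\<lambda>v. ltrans G GM w (\<one> \<otimes> b) (rtrans G GM \<one> v b))"
    using w b
    by (intro has_tangent_map_comp[OF has_tangent_map_rtrans has_tangent_map_ltrans] charted_group) auto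
  moreover have "has_tangent_map GM GM (\<lambda>x. (w \<otimes> x \<otimes> inv w) \<otimes> (w \<otimes> b)) \<one>
          (\<lambda>v. rtrans G GM (w \<otimes> \<one> \<otimes> inv w) (Ad G GM w v) (w \<otimes> b))"
    using w b
    by (intro has_tangent_map_comp[OF has_tangent_map_Ad has_tangent_map_rtrans] charted_group) auto
  \<comment> \<open>The two factorizations agree on group elements only, but the chart domain consists of those.\<close>
  moreover have "w \<otimes> (x \<otimes> b) = (w \<otimes> x \<otimes> inv w) \<otimes> (w \<otimes> b)"
    if "x \<in> fst (chart_at GM \<one>)" for x
  proof -
    have "x \<in> carrier G"
      using that charted_fst_subset[OF charted_group, of \<one>] group_points by auto
    moreover have "inv w \<otimes> (w \<otimes> b) = b"
      using w b by (simp flip: m_assoc)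
    ultimately show ?thesis
      using w b by (simp add: m_assoc)
  qed
  ultimately have "(\<lambda>v. ltrans G GM w (\<one> \<otimes> b) (rtrans G GM \<one> v b))
      = (\<lambda>v. rtrans G GM (w \<otimes> \<one> \<otimes> inv w) (Ad G GM w v) (w \<otimes> b))"
    by (metis (no_types, lifting) has_tangent_map_cong has_tangent_map_unique charted_group one_closed)
  then show ?thesis
    using w b by (auto dest: fun_cong[of _ _ \<eta>])
qed

lemma ltrans_zero:
  "w \<in> carrier G \<Longrightarrow> h \<in> carrier G \<Longrightarrow> ltrans G GM w h 0 = 0"
  using has_tangent_map_linear[OF has_tangent_map_ltrans] by (metis linear_0 bounded_linear.linear)

lemma rtrans_zero:
  "w \<in> carrier G \<Longrightarrow> h \<in> carrier G \<Longrightarrow> rtrans G GM h 0 w = 0"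
  using linear_0[OF bounded_linear.linear[OF has_tangent_map_linear[OF has_tangent_map_rtrans]]] .

lemma Ad_zero: "w \<in> carrier G \<Longrightarrow> Ad G GM w 0 = 0"
  using has_tangent_map_linear[OF has_tangent_map_Ad] by (metis linear_0 bounded_linear.linear)

end

section \<open>The differential of a reduced function along a reduced variation\<close>

lemma triple_partial_derivatives:
  fixes f :: "'b \<times> 'b \<times> 'g \<Rightarrow> real"
    and M :: "('b, 'eb::real_normed_vector) manifold"
    and GM :: "('g, 'eg::real_normed_vector) manifold"
  assumes f: "has_tangent_map (M \<times>\<^sub>m M \<times>\<^sub>m GM) real_mfd f (x, y, w) T"
    and c: "charted M x" "charted M y" "charted GM w"
  shows "D1 M f (x, y, w) = (\<lambda>v. T (v, 0, 0))"
    and "D2 M f (x, y, w) = (\<lambda>v. T (0, v, 0))"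
    and "D3 GM f (x, y, w) = (\<lambda>v. T (0, 0, v))"
proof -
  have yw: "charted (M \<times>\<^sub>m GM) (y, w)" using c by (simp add: charted_prod)
  show "D1 M f (x, y, w) = (\<lambda>v. T (v, 0, 0))"
    using has_tangent_map_unique[OF has_tangent_map_slice1[OF f c(1) yw]]
    by (simp add: D1_def zero_prod_def)
  note s = has_tangent_map_slice2[OF f c(1) yw]
  show "D2 M f (x, y, w) = (\<lambda>v. T (0, v, 0))"
    using has_tangent_map_unique[OF has_tangent_map_slice1[OF s c(2,3)]] by (simp add: D2_def)
  show "D3 GM f (x, y, w) = (\<lambda>v. T (0, 0, v))"
    using has_tangent_map_unique[OF has_tangent_map_slice2[OF s c(2,3)]] by (simp add: D3_def)
qed

text \<open>The grouping on the right-hand side is the one that summation by parts needs: the first bracket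
  belongs to the left endpoint \<open>(v, \<eta>)\<close> of the step and the second to the right endpoint
  \<open>(v', \<eta>')\<close>. The covector \<open>\<rho>\<close> is the right-trivialization of \<open>D\<^sub>3 f\<close>.\<close>

lemma (in lie_group) differential_reduced_variation:
  fixes M :: "('b, 'eb::real_normed_vector) manifold" and f :: "'b \<times> 'b \<times> 'g \<Rightarrow> real"
    and A :: "'b \<times> 'b \<Rightarrow> 'g"
  assumes f: "has_tangent_map (M \<times>\<^sub>m M \<times>\<^sub>m GM) real_mfd f a T"
    and a: "a = (x, y, w \<otimes> A (x, y))"
    and c: "charted M x" "charted M y" and w: "w \<in> carrier G" and A: "A (x, y) \<in> carrier G"
  defines "\<rho> \<equiv> \<lambda>\<eta>. D3 GM f a (rtrans G GM \<one> \<eta> (w \<otimes> A (x, y)))"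
  shows "T (v, v', - rtrans G GM \<one> \<eta> (w \<otimes> A (x, y))
               + ltrans G GM w (A (x, y)) (rtrans G GM \<one> \<eta>' (A (x, y)))
               + ltrans G GM w (A (x, y)) (DA1 M GM A (x, y) v)
               + ltrans G GM w (A (x, y)) (DA2 M GM A (x, y) v'))
         = (D1 M f a v + T_LWA1 G GM M A w (x, y) (D3 GM f a) v - \<rho> \<eta>)
         + (D2 M f a v' + T_LWA2 G GM M A w (x, y) (D3 GM f a) v' + Ad_star G GM w \<rho> \<eta>')"
proof -
  have wA: "charted GM (w \<otimes> A (x, y))" using w A by (simp add: charted_group)
  note D = triple_partial_derivatives[OF f[unfolded a] c wA, folded a]
  interpret T: bounded_linear T using f by (rule has_tangent_map_linear)
  have split: "T (u, u', z) = T (u, 0, 0) + T (0, u', 0) + T (0, 0, z)" for u u' z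
    by (simp flip: T.add)
  have add: "T (0, 0, z + z') = T (0, 0, z) + T (0, 0, z')" for z z'
    by (simp flip: T.add)
  have minus: "T (0, 0, - z) = - T (0, 0, z)" for z
    using T.diff[of 0 "(0, 0, z)"] by (simp add: T.zero)
  show ?thesis
    unfolding split[of v v'] add minus
    by (simp add: D \<rho>_def T_LWA1_def T_LWA2_def Ad_star_def ltrans_rtrans_eq_rtrans_Ad w A)
qed

text \<open>These values dispose of the boundary terms, where \<open>\<delta>p\<close> and \<open>\<eta>\<close> vanish. The last two involve the
  derivatives of \<open>A\<close>, so they rely on its smoothness.\<close>

lemma (in lie_group) reduced_covectors_zero:
  fixes M :: "('b, 'eb::real_normed_vector) manifold" and f :: "'b \<times> 'b \<times> 'g \<Rightarrow> real"
    and A :: "'b \<times> 'b \<Rightarrow> 'g"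
  assumes f: "has_tangent_map (M \<times>\<^sub>m M \<times>\<^sub>m GM) real_mfd f a T"
    and a: "a = (x, y, w \<otimes> A (x, y))"
    and c: "charted M x" "charted M y" and w: "w \<in> carrier G" and A: "A (x, y) \<in> carrier G"
    and smooth_A: "smooth_map (M \<times>\<^sub>m M) GM A"
  shows "D1 M f a 0 = 0" "D2 M f a 0 = 0" "D3 GM f a 0 = 0"
    "T_LWA1 G GM M A w (x, y) (D3 GM f a) 0 = 0"
    "T_LWA2 G GM M A w (x, y) (D3 GM f a) 0 = 0"
proof -
  have wA: "charted GM (w \<otimes> A (x, y))" using w A by (simp add: charted_group)
  note D = triple_partial_derivatives[OF f[unfolded a] c wA, folded a]
  interpret T: bounded_linear T using f by (rule has_tangent_map_linear)
  show D0: "D1 M f a 0 = 0" "D2 M f a 0 = 0" "D3 GM f a 0 = 0"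
    using T.zero by (simp_all add: D zero_prod_def)
  have dA: "has_tangent_map (M \<times>\<^sub>m M) GM A (x, y) (tangent_map (M \<times>\<^sub>m M) GM A (x, y))"
    using smooth_A c A by (intro smooth_map_has_tangent_map charted_prod charted_group)
  have "DA1 M GM A (x, y) 0 = 0" "DA2 M GM A (x, y) 0 = 0"
    using has_tangent_map_unique[OF has_tangent_map_slice1[OF dA c]]
      has_tangent_map_unique[OF has_tangent_map_slice2[OF dA c]]
      linear_0[OF bounded_linear.linear[OF has_tangent_map_linear[OF dA]]]
    by (simp_all add: DA1_def DA2_def zero_prod_def)
  then show "T_LWA1 G GM M A w (x, y) (D3 GM f a) 0 = 0"
    "T_LWA2 G GM M A w (x, y) (D3 GM f a) 0 = 0"
    using D0 w A by (simp_all add: T_LWA1_def T_LWA2_def ltrans_zero)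
qed

section \<open>First variation of the action sum\<close>

text \<open>By the product rule the variation of the multipliers enters only through
  \<open>\<delta>lam n \<alpha> * \<kappa> \<alpha> (a n)\<close>, hence the constraints make \<open>\<delta>lam\<close> disappear from the result.\<close>

lemma action_sum_derivative:
  assumes c: "\<And>n. n < N \<Longrightarrow> smooth_curve M (c n) (a n) (\<delta>a n)"
    and l: "\<And>n \<alpha>. n < N \<Longrightarrow> \<alpha> \<in> {1..m} \<Longrightarrow> smooth_curve real_mfd (l n \<alpha>) (lam n \<alpha>) (\<delta>lam n \<alpha>)"
    and M: "\<And>n. n < N \<Longrightarrow> charted M (a n)"
    and L: "\<And>n. n < N \<Longrightarrow> has_tangent_map M real_mfd L (a n) (dL n)"
    and \<kappa>: "\<And>n \<alpha>. n < N \<Longrightarrow> \<alpha> \<in> {1..m} \<Longrightarrow> has_tangent_map M real_mfd (\<kappa> \<alpha>) (a n) (d\<kappa> n \<alpha>)"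
    and constraint: "\<And>n \<alpha>. n < N \<Longrightarrow> \<alpha> \<in> {1..m} \<Longrightarrow> \<kappa> \<alpha> (a n) = 0"
  shows "((\<lambda>t. action_sum N m L \<kappa> (\<lambda>n. c n t) (\<lambda>n \<alpha>. l n \<alpha> t)) has_real_derivative
           (\<Sum>n<N. dL n (\<delta>a n) + (\<Sum>\<alpha>=1..m. lam n \<alpha> * d\<kappa> n \<alpha> (\<delta>a n)))) (at 0)"
  unfolding action_sum_def
proof (intro DERIV_sum DERIV_add)
  fix n assume "n \<in> {..<N}"
  then have n: "n < N" by simp
  show "((\<lambda>t. L (c n t)) has_real_derivative dL n (\<delta>a n)) (at 0)"
    using derivative_along_smooth_curve[OF c M L] n by blast
  fix \<alpha> assume \<alpha>: "\<alpha> \<in> {1..m}"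
  have "((\<lambda>t. l n \<alpha> t * \<kappa> \<alpha> (c n t)) has_real_derivative
      \<delta>lam n \<alpha> * \<kappa> \<alpha> (c n 0) + d\<kappa> n \<alpha> (\<delta>a n) * l n \<alpha> 0) (at 0)"
    using derivative_along_smooth_curve[OF c[OF n] M[OF n] \<kappa>[OF n \<alpha>]]
      derivative_smooth_real_curve[OF l[OF n \<alpha>]] by (intro DERIV_mult)
  moreover have "c n 0 = a n" "l n \<alpha> 0 = lam n \<alpha>"
    using c[OF n] l[OF n \<alpha>] by (simp_all add: smooth_curve_def)
  ultimately show "((\<lambda>t. l n \<alpha> t * \<kappa> \<alpha> (c n t)) has_real_derivative lam n \<alpha> * d\<kappa> n \<alpha> (\<delta>a n)) (at 0)"
    using constraint[OF n \<alpha>] by (simp add: mult.commute)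
qed

text \<open>Summation by parts: \<open>P n\<close> is the share of step \<open>n\<close> at its left endpoint \<open>n\<close>, and \<open>R n\<close> that at its
  right endpoint \<open>n + 1\<close>.\<close>

lemma sum_by_parts_eq_zero:
  fixes P R :: "nat \<Rightarrow> 'a::ab_group_add"
  assumes "P 0 = 0" and "0 < N \<Longrightarrow> R (N - 1) = 0"
    and inner: "\<And>n. n \<in> {1..<N} \<Longrightarrow> P n + R (n - 1) = 0"
  shows "(\<Sum>n<N. P n + R n) = 0"
proof -
  have "(\<Sum>n<Suc k. P n + R n) = R k" if "k < N" for k
    using that
  proof (induction k)
    case 0
    then show ?case using assms(1) by simp
  next
    case (Suc k)
    then have "(\<Sum>n<Suc (Suc k). P n + R n) = R k + (P (Suc k) + R (Suc k))"
      by simp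
    also have "\<dots> = (P (Suc k) + R k) + R (Suc k)"
      by (simp add: algebra_simps)
    also have "\<dots> = R (Suc k)"
      using inner[of "Suc k"] Suc.prems by simp
    finally show ?case .
  qed
  from this[of "N - 1"] show ?thesis
    using assms(2) by (cases N) auto
qed

lemma openin_mfd_topology_subset: "openin (mfd_topology M) U \<Longrightarrow> U \<subseteq> points M"
proof -
  have "topspace (mfd_topology M) \<subseteq> points M"
    by (auto simp: mfd_topology_def topology_generated_by_topspace points_def)
  then show "openin (mfd_topology M) U \<Longrightarrow> U \<subseteq> points M"
    using openin_subset by blast
qed

theorem theorem3p2:
  fixes G :: "('g, 'r) monoid_scheme"
    and GM :: "('g, 'eg::real_normed_vector) manifold"
    and Q :: "('q, 'eq::real_normed_vector) manifold"
    and act :: "'g \<Rightarrow> 'q \<Rightarrow> 'q"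
    and B M :: "('q set, 'eb::real_normed_vector) manifold"
    and U :: "'q set set"
    and \<Phi> :: "'q set \<times> 'g \<Rightarrow> 'q"
    and \<A> :: "'q \<times> 'q \<Rightarrow> 'g"
    and A :: "'q set \<times> 'q set \<Rightarrow> 'g"
    and N m :: nat
    and L :: "'q set \<times> 'q set \<times> 'g \<Rightarrow> real"
    and \<kappa> :: "nat \<Rightarrow> 'q set \<times> 'q set \<times> 'g \<Rightarrow> real"
    and p :: "nat \<Rightarrow> 'q set" and g :: "nat \<Rightarrow> 'g" and lam :: "nat \<Rightarrow> nat \<Rightarrow> real"
    and W An :: "nat \<Rightarrow> 'g"
    and a :: "nat \<Rightarrow> 'q set \<times> 'q set \<times> 'g"
    and \<mu> :: "nat \<Rightarrow> 'eg \<Rightarrow> real" and \<epsilon> :: "nat \<Rightarrow> nat \<Rightarrow> 'eg \<Rightarrow> real"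
  assumes trivialized: "trivialized_bundle G GM Q act B U \<Phi>"
    and M: "M = open_sub B U"
    and connection: "discrete_connection G (points Q) act \<A>"
    and A: "A = local_rep G \<Phi> \<A>"
    and smooth_A: "smooth_map (M \<times>\<^sub>m M) GM A"
    and smooth_L: "smooth_map (M \<times>\<^sub>m M \<times>\<^sub>m GM) real_mfd L"
    and smooth_\<kappa>: "\<And>\<alpha>. \<alpha> \<in> {1..m} \<Longrightarrow> smooth_map (M \<times>\<^sub>m M \<times>\<^sub>m GM) real_mfd (\<kappa> \<alpha>)"
    and q: "\<And>n. n \<le> N \<Longrightarrow> p n \<in> U \<and> g n \<in> carrier G"
    and W: "\<And>n. n < N \<Longrightarrow> W n = inv\<^bsub>G\<^esub> (g n) \<otimes>\<^bsub>G\<^esub> g (Suc n)"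
    and An: "\<And>n. n < N \<Longrightarrow> An n = A (p n, p (Suc n))"
    and a: "\<And>n. n < N \<Longrightarrow> a n = (p n, p (Suc n), W n \<otimes>\<^bsub>G\<^esub> An n)"
    and \<mu>: "\<And>n. n < N \<Longrightarrow> \<mu> n = (\<lambda>\<eta>. D3 GM L (a n) (rtrans G GM \<one>\<^bsub>G\<^esub> \<eta> (W n \<otimes>\<^bsub>G\<^esub> An n)))"
    and \<epsilon>: "\<And>n \<alpha>. n < N \<Longrightarrow> \<alpha> \<in> {1..m} \<Longrightarrow>
           \<epsilon> n \<alpha> = (\<lambda>\<eta>. D3 GM (\<kappa> \<alpha>) (a n) (rtrans G GM \<one>\<^bsub>G\<^esub> \<eta> (W n \<otimes>\<^bsub>G\<^esub> An n)))"
    and horizontal_eq: "\<And>n v. n \<in> {1..<N} \<Longrightarrow>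
           0 = D1 M L (a n) v + D2 M L (a (n-1)) v
             + T_LWA1 G GM M A (W n) (p n, p (n+1)) (D3 GM L (a n)) v
             + T_LWA2 G GM M A (W (n-1)) (p (n-1), p n) (D3 GM L (a (n-1))) v
             + (\<Sum>\<alpha>=1..m. lam n \<alpha> *
                  (D1 M (\<kappa> \<alpha>) (a n) v
                   + T_LWA1 G GM M A (W n) (p n, p (n+1)) (D3 GM (\<kappa> \<alpha>) (a n)) v))
             + (\<Sum>\<alpha>=1..m. lam (n-1) \<alpha> *
                  (D2 M (\<kappa> \<alpha>) (a (n-1)) v
                   + T_LWA2 G GM M A (W (n-1)) (p (n-1), p n) (D3 GM (\<kappa> \<alpha>) (a (n-1))) v))"
    and vertical_eq: "\<And>n \<eta>. n \<in> {1..<N} \<Longrightarrow>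
           \<mu> n \<eta> = Ad_star G GM (W (n-1)) (\<mu> (n-1)) \<eta>
             - (\<Sum>\<alpha>=1..m. lam n \<alpha> * \<epsilon> n \<alpha> \<eta>)
             + (\<Sum>\<alpha>=1..m. lam (n-1) \<alpha> * Ad_star G GM (W (n-1)) (\<epsilon> (n-1) \<alpha>) \<eta>)"
    and constraint_eq: "\<And>n \<alpha>. n < N \<Longrightarrow> \<alpha> \<in> {1..m} \<Longrightarrow> 0 = \<kappa> \<alpha> (a n)"
  shows "\<forall>\<delta>p \<delta>g \<eta> \<delta>a \<delta>lam.
           \<delta>p 0 = 0 \<and> \<delta>p N = 0 \<and> \<delta>g 0 = 0 \<and> \<delta>g N = 0 \<and>
           (\<forall>n\<le>N. \<eta> n = ltrans G GM (inv\<^bsub>G\<^esub> (g n)) (g n) (\<delta>g n)) \<and>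
           (\<forall>n<N. \<delta>a n =
              (\<delta>p n, \<delta>p (Suc n),
               - rtrans G GM \<one>\<^bsub>G\<^esub> (\<eta> n) (W n \<otimes>\<^bsub>G\<^esub> An n)
               + ltrans G GM (W n) (An n) (rtrans G GM \<one>\<^bsub>G\<^esub> (\<eta> (Suc n)) (An n))
               + ltrans G GM (W n) (An n) (DA1 M GM A (p n, p (Suc n)) (\<delta>p n))
               + ltrans G GM (W n) (An n) (DA2 M GM A (p n, p (Suc n)) (\<delta>p (Suc n)))))
           \<longrightarrow> stationary_along (M \<times>\<^sub>m M \<times>\<^sub>m GM) N m L \<kappa> a lam \<delta>a \<delta>lam"
proof (intro allI impI)
  interpret trivialized_bundle G GM Q act B U \<Phi> by (rule trivialized)
  fix \<delta>p \<delta>g \<eta> \<delta>a \<delta>lam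
  assume *: "\<delta>p 0 = 0 \<and> \<delta>p N = 0 \<and> \<delta>g 0 = 0 \<and> \<delta>g N = 0 \<and>
           (\<forall>n\<le>N. \<eta> n = ltrans G GM (inv\<^bsub>G\<^esub> (g n)) (g n) (\<delta>g n)) \<and>
           (\<forall>n<N. \<delta>a n =
              (\<delta>p n, \<delta>p (Suc n),
               - rtrans G GM \<one>\<^bsub>G\<^esub> (\<eta> n) (W n \<otimes>\<^bsub>G\<^esub> An n)
               + ltrans G GM (W n) (An n) (rtrans G GM \<one>\<^bsub>G\<^esub> (\<eta> (Suc n)) (An n))
               + ltrans G GM (W n) (An n) (DA1 M GM A (p n, p (Suc n)) (\<delta>p n))
               + ltrans G GM (W n) (An n) (DA2 M GM A (p n, p (Suc n)) (\<delta>p (Suc n)))))"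
  let ?MM = "M \<times>\<^sub>m M \<times>\<^sub>m GM"
  have chM: "charted M (p n)" if "n \<le> N" for n
    using q[OF that] openin_mfd_topology_subset[OF open_U] base_manifold
    by (auto simp: M intro: charted_open_sub charted_smooth_manifold)
  have Wc: "W n \<in> carrier G" if "n < N" for n
    using W[OF that] q[of n] q[of "Suc n"] that by simp
  have Ac: "A (p n, p (Suc n)) \<in> carrier G" if "n < N" for n
  proof -
    have ch: "charted (M \<times>\<^sub>m M) (p n, p (Suc n))"
      using that by (simp add: charted_prod chM)
    then have "(p n, p (Suc n)) \<in> points (M \<times>\<^sub>m M)"
      using charted_fst_subset[OF ch] by (auto simp only: charted_def)
    then show ?thesis
      using smooth_A group_points unfolding smooth_map_def by blast
  qed
  have chMM: "charted ?MM (a n)" if "n < N" for n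
    using that Wc Ac by (auto simp: a An intro!: charted_prod chM charted_group)
  have dL: "has_tangent_map ?MM real_mfd L (a n) (tangent_map ?MM real_mfd L (a n))" if "n < N" for n
    using that smooth_L chMM by (intro smooth_map_has_tangent_map charted_real)
  have d\<kappa>: "has_tangent_map ?MM real_mfd (\<kappa> \<alpha>) (a n) (tangent_map ?MM real_mfd (\<kappa> \<alpha>) (a n))"
    if "n < N" "\<alpha> \<in> {1..m}" for n \<alpha>
    using that smooth_\<kappa> chMM by (intro smooth_map_has_tangent_map charted_real)
  have \<eta>0: "\<eta> 0 = 0" "\<eta> N = 0"
    using * q[of 0] q[of N] by (simp_all add: ltrans_zero)
  let ?P = "\<lambda>f n. D1 M f (a n) (\<delta>p n)
      + T_LWA1 G GM M A (W n) (p n, p (Suc n)) (D3 GM f (a n)) (\<delta>p n)"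
  let ?R = "\<lambda>f n. D2 M f (a n) (\<delta>p (Suc n))
      + T_LWA2 G GM M A (W n) (p n, p (Suc n)) (D3 GM f (a n)) (\<delta>p (Suc n))"
  have a': "a n = (p n, p (Suc n), W n \<otimes>\<^bsub>G\<^esub> A (p n, p (Suc n)))" if "n < N" for n
    using that by (simp add: a An)
  have dL_eq: "tangent_map ?MM real_mfd L (a n) (\<delta>a n)
      = (?P L n - \<mu> n (\<eta> n)) + (?R L n + Ad_star G GM (W n) (\<mu> n) (\<eta> (Suc n)))"
    if "n < N" for n
    using differential_reduced_variation[where A = A and x = "p n" and y = "p (Suc n)" and w = "W n",
        OF dL[OF that] a'[OF that] chM chM Wc[OF that] Ac[OF that],
        of "\<delta>p n" "\<delta>p (Suc n)" "\<eta> n" "\<eta> (Suc n)"]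
      that *
    by (simp add: \<mu> An)
  have d\<kappa>_eq: "tangent_map ?MM real_mfd (\<kappa> \<alpha>) (a n) (\<delta>a n)
      = (?P (\<kappa> \<alpha>) n - \<epsilon> n \<alpha> (\<eta> n)) + (?R (\<kappa> \<alpha>) n + Ad_star G GM (W n) (\<epsilon> n \<alpha>) (\<eta> (Suc n)))"
    if "n < N" "\<alpha> \<in> {1..m}" for n \<alpha>
    using differential_reduced_variation[where A = A and x = "p n" and y = "p (Suc n)" and w = "W n",
        OF d\<kappa>[OF that] a'[OF that(1)] chM chM Wc[OF that(1)] Ac[OF that(1)],
        of "\<delta>p n" "\<delta>p (Suc n)" "\<eta> n" "\<eta> (Suc n)"]
      that *
    by (simp add: \<epsilon> An)
  \<comment> \<open>\<open>P n\<close> collects everything in step \<open>n\<close> that depends on \<open>\<delta>p n\<close> and \<open>\<eta> n\<close>, and \<open>R n\<close> everything that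
    depends on \<open>\<delta>p (Suc n)\<close> and \<open>\<eta> (Suc n)\<close>.\<close>
  define P where "P n = ?P L n - \<mu> n (\<eta> n)
      + (\<Sum>\<alpha>=1..m. lam n \<alpha> * (?P (\<kappa> \<alpha>) n - \<epsilon> n \<alpha> (\<eta> n)))" for n
  define R where "R n = ?R L n + Ad_star G GM (W n) (\<mu> n) (\<eta> (Suc n))
      + (\<Sum>\<alpha>=1..m. lam n \<alpha> * (?R (\<kappa> \<alpha>) n + Ad_star G GM (W n) (\<epsilon> n \<alpha>) (\<eta> (Suc n))))" for n
  note zero_L = reduced_covectors_zero[where A = A and x = "p n" and y = "p (Suc n)" and w = "W n" for n,
      OF dL a' chM chM Wc Ac smooth_A]
  note zero_\<kappa> = reduced_covectors_zero[where A = A and x = "p n" and y = "p (Suc n)" and w = "W n" for n,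
      OF d\<kappa> a' chM chM Wc Ac smooth_A]
  have wA: "W n \<otimes>\<^bsub>G\<^esub> An n \<in> carrier G" if "n < N" for n
    using that by (simp add: An Wc Ac)
  have variation: "(\<Sum>n<N. tangent_map ?MM real_mfd L (a n) (\<delta>a n)
      + (\<Sum>\<alpha>=1..m. lam n \<alpha> * tangent_map ?MM real_mfd (\<kappa> \<alpha>) (a n) (\<delta>a n))) = (\<Sum>n<N. P n + R n)"
    by (intro sum.cong refl) (simp add: P_def R_def dL_eq d\<kappa>_eq distrib_left sum.distrib)
  have "(\<Sum>n<N. P n + R n) = 0"
  proof (cases "N = 0")
    case False
    then have N: "0 < N" "N - 1 < N" "Suc (N - 1) = N" by simp_all
    show ?thesis
    proof (rule sum_by_parts_eq_zero)
      show "P 0 = 0"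
        using * N zero_L[of 0] zero_\<kappa>[of 0] by (simp add: P_def \<eta>0 \<mu> \<epsilon> rtrans_zero wA)
      show "R (N - 1) = 0"
        using * N zero_L[of "N - 1"] zero_\<kappa>[of "N - 1"]
        by (simp add: R_def \<eta>0 \<mu> \<epsilon> rtrans_zero wA Ad_star_def Ad_zero Wc)
      show "P n + R (n - 1) = 0" if n: "n \<in> {1..<N}" for n
      proof -
        have S: "Suc (n - 1) = n" using n by auto
        \<comment> \<open>At an interior point \<open>P n + R (n - 1)\<close> is the right-hand side of the horizontal equation
          minus the difference of the two sides of the vertical one.\<close>
        show ?thesis
          using horizontal_eq[OF n, of "\<delta>p n"] vertical_eq[OF n, of "\<eta> n"]
          unfolding P_def R_def S
          by (simp add: distrib_left right_diff_distrib sum.distrib sum_subtractf)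
      qed
    qed
  qed simp
  then show "stationary_along ?MM N m L \<kappa> a lam \<delta>a \<delta>lam"
    unfolding stationary_along_def
    using action_sum_derivative[of N ?MM _ a \<delta>a m _ lam \<delta>lam L
        "\<lambda>n. tangent_map ?MM real_mfd L (a n)" \<kappa> "\<lambda>n \<alpha>. tangent_map ?MM real_mfd (\<kappa> \<alpha>) (a n)"]
      chMM dL d\<kappa> constraint_eq variation
    by simp
qed

end
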